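(* There exists a constant $c_3 > 0$ such that the following holds for all positive integers $n$. Let $b$ be a positive integer such that $\log n \leq b \leq \frac{n}{(\log n)^2}$ and define, for $1 \leq i \leq n$, $a_i = 2i$ if $b \mid i$ and $a_i = 2i-1$ otherwise. Then $|S(a)| \geq c_3 n^2$.
   Context: For a finite sequence of integers $a = (a_i)_{1 \leq i \leq k}$, $S(a) = \{\sum_{i=u}^{v} a_i \mid 1 \leq u \leq v \leq k\}$ is the set of its consecutive sums. *)

theory Defs
  imports Complex_Main
begin

text \<open>A finite sequence of length \<open>k\<close> is represented by a function on the naturals of which
  only the values at \<open>1, \<dots>, k\<close> are used.\<close>

definition consecutive_sums :: "nat \<Rightarrow> (nat \<Rightarrow> int) \<Rightarrow> int set" where
  "consecutive_sums k a = {\<Sum>i=u..v. a i | u v. 1 \<le> u \<and> u \<le> v \<and> v \<le> k}"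

definition perturbed_odd_seq :: "nat \<Rightarrow> nat \<Rightarrow> int" where
  "perturbed_odd_seq b i = (if b dvd i then 2 * int i else 2 * int i - 1)"

end

theory Submission
  imports Defs "HOL-Analysis.Convex"
begin

text \<open>The sum over \<open>u < i \<le> u + d\<close> equals \<open>d (2u + d) + \<lfloor>(u + d) / b\<rfloor> - \<lfloor>u / b\<rfloor>\<close>, which is
  \<open>d (2u + d) + \<lfloor>d / b\<rfloor>\<close> up to a carry in \<open>{0, 1}\<close>. By Cauchy-Schwarz it suffices to bound by
  \<open>O(n\<^sup>2)\<close> the number of coincidences between such values with the same carry and with \<open>d\<close> of
  order \<open>n\<close>. Two lengths \<open>d, e\<close> with greatest common divisor \<open>g\<close> admit \<open>O(g)\<close> coincidences, and
  none unless \<open>g\<close> divides \<open>\<lfloor>d / b\<rfloor> - \<lfloor>e / b\<rfloor>\<close>. Apart from \<open>d = e\<close>, the pairs with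
  \<open>\<lfloor>d / b\<rfloor> = \<lfloor>e / b\<rfloor>\<close> contribute \<open>O(n b log n)\<close> and the others \<open>O(n\<^sup>2 + n\<^sup>2 log n / b)\<close>;
  the hypotheses on \<open>b\<close> make both \<open>O(n\<^sup>2)\<close>.\<close>

section \<open>Cauchy-Schwarz on fibres, residue classes in intervals, and harmonic sums\<close>

text \<open>The fibres of \<open>f\<close> partition \<open>A\<close>, and the collisions are the
  pairs inside a common fibre. So the fibre sizes sum to \<open>card A\<close> and their squares to
  the number of collisions; Cauchy-Schwarz over the image compares the two.\<close>

lemma card_squared_le_card_image_times_collisions:
  assumes "finite A"
  shows "(real (card A))\<^sup>2 \<le> real (card (f ` A)) * real (card {(x, y) \<in> A \<times> A. f x = f y})"
proof -
  define r where "r t = {x \<in> A. f x = t}" for t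
  have fin: "finite (r t)" for t
    using assms by (simp add: r_def)
  have "card A = card (\<Union>t\<in>f ` A. r t)"
    by (rule arg_cong[where f = card]) (auto simp: r_def)
  also have "\<dots> = (\<Sum>t\<in>f ` A. card (r t))"
    using assms fin by (subst card_UN_disjoint) (auto simp: r_def)
  finally have A: "real (card A) = (\<Sum>t\<in>f ` A. real (card (r t)))"
    by simp
  have "card {(x, y) \<in> A \<times> A. f x = f y} = card (\<Union>t\<in>f ` A. r t \<times> r t)"
    by (rule arg_cong[where f = card]) (auto simp: r_def)
  also have "\<dots> = (\<Sum>t\<in>f ` A. card (r t \<times> r t))"
    using assms fin by (subst card_UN_disjoint) (auto simp: r_def)
  finally have "real (card {(x, y) \<in> A \<times> A. f x = f y}) = (\<Sum>t\<in>f ` A. (real (card (r t)))\<^sup>2)"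
    by (simp add: card_cartesian_product power2_eq_square)
  then show ?thesis
    using sum_squared_le_sum_of_squares[of "\<lambda>t. real (card (r t))" "f ` A"] A
    by (simp add: mult.commute)
qed

text \<open>After translation by \<open>a\<close> all elements share one remainder modulo
  \<open>g\<close>, so each is determined by its quotient, which is at most
  \<open>L div g\<close>.\<close>

lemma card_congruent_subset_le:
  fixes a L g :: nat
  assumes "g > 0" "A \<subseteq> {a..<a + L}" "\<And>x y. x \<in> A \<Longrightarrow> y \<in> A \<Longrightarrow> x mod g = y mod g"
  shows "card A \<le> L div g + 1"
proof -
  have "inj_on (\<lambda>x. (x - a) div g) A"
  proof (rule inj_onI)
    fix x y assume xy: "x \<in> A" "y \<in> A" "(x - a) div g = (y - a) div g"
    have le: "a \<le> x" "a \<le> y"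
      using xy assms(2) by auto
    have "int x mod int g = int y mod int g"
      using assms(3)[OF xy(1,2)] by (simp flip: of_nat_mod)
    then have "(int x - int a) mod int g = (int y - int a) mod int g"
      by (rule mod_diff_cong) simp
    then have "(x - a) mod g = (y - a) mod g"
      using le by (simp flip: of_nat_diff of_nat_mod)
    with xy(3) have "x - a = y - a"
      by (metis div_mult_mod_eq)
    with le show "x = y"
      by simp
  qed
  moreover have "(\<lambda>x. (x - a) div g) ` A \<subseteq> {..L div g}"
  proof -
    have "x - a \<le> L" if "x \<in> A" for x
      using that assms(2) by force
    then show ?thesis
      by (auto intro: div_le_mono)
  qed
  ultimately have "card A \<le> card {..L div g}"
    by (rule card_inj_on_le) simp
  then show ?thesis
    by simp
qed

lemma sum_inverse_le_ln:
  assumes "m > 0"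
  shows "(\<Sum>g=1..m. 1 / real g) \<le> 1 + ln (real m)"
  using assms
proof (induction m rule: nat_induct_non_zero)
  case 1
  then show ?case by simp
next
  case (Suc m)
  have "ln (real m / real (Suc m)) \<le> real m / real (Suc m) - 1"
    using Suc by (intro ln_le_minus_one) simp
  also have "\<dots> = - (1 / real (Suc m))"
    by (simp add: field_simps)
  finally have "1 / real (Suc m) \<le> ln (real (Suc m)) - ln (real m)"
    using Suc by (simp add: ln_div)
  with Suc show ?case
    by simp
qed

lemma sum_inverse_squares_le: "(\<Sum>g=1..m. 1 / (real g)\<^sup>2) \<le> 2"
proof -
  \<comment> \<open>The constant bound 2 is not inductive; the sharper bound is, since the next term
    \<open>1 / (m + 1)^2\<close> is at most \<open>1 / m - 1 / (m + 1)\<close>.\<close>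
  have "(\<Sum>g=1..m. 1 / (real g)\<^sup>2) \<le> 2 - 1 / real m" if "m > 0"
    using that
  proof (induction m rule: nat_induct_non_zero)
    case 1
    then show ?case by simp
  next
    case (Suc m)
    have "1 / (real (Suc m))\<^sup>2 \<le> 1 / (real m * real (Suc m))"
      using Suc by (intro divide_left_mono) (auto simp: power2_eq_square)
    also have "\<dots> = 1 / real m - 1 / real (Suc m)"
      using Suc by (simp add: field_simps)
    finally show ?case
      using Suc by simp
  qed
  then show ?thesis
    by (cases "m > 0") (force intro: order_trans)+
qed

section \<open>Closed form of the consecutive sums, and collisions between two fixed lengths\<close>

text \<open>The odd numbers with indices from \<open>u + 1\<close> to \<open>u + d\<close> sum to
  \<open>(u + d)^2 - u^2 = d * (2 * u + d)\<close>, and every multiple of \<open>b\<close> among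
  these indices adds 1.\<close>

lemma sum_perturbed_odd_seq:
  assumes "b > 0"
  shows "(\<Sum>i=u+1..u+d. perturbed_odd_seq b i)
    = int (d * (2 * u + d) + (u + d) div b) - int (u div b)"
proof (induction d)
  case 0
  then show ?case by simp
next
  case (Suc d)
  have "(\<Sum>i=u+1..u+Suc d. perturbed_odd_seq b i)
      = (\<Sum>i=u+1..u+d. perturbed_odd_seq b i) + perturbed_odd_seq b (Suc (u + d))"
    by simp
  then show ?case
    unfolding Suc.IH
    by (simp add: perturbed_odd_seq_def div_Suc mod_eq_0_iff_dvd algebra_simps)
qed

text \<open>For fixed lengths \<open>d\<close> and \<open>e\<close> the equation is linear in \<open>(u, w)\<close>, so its solutions
  lie in a single residue class of \<open>u\<close> modulo \<open>e / gcd d e\<close>.\<close>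

lemma card_collisions_fixed_lengths:
  fixes d e M b :: nat
  defines "Q \<equiv> {(u, w). u < 2 * M \<and> w < 2 * M \<and>
    d * (2 * u + d) + d div b = e * (2 * w + e) + e div b}"
  assumes "M < d" "M < e"
  shows "card Q \<le> (if (d div b) mod gcd d e = (e div b) mod gcd d e then 3 * gcd d e else 0)"
proof -
  define g where "g = gcd d e"
  obtain d1 e1 where de: "d = g * d1" "e = g * e1" "coprime d1 e1"
    using assms gcd_coprime_exists[of d e] unfolding g_def by (auto simp: mult.commute)
  have pos: "g > 0" "e1 > 0" "d > 0" "e > 0"
    using assms de by (auto intro: Nat.gr0I)
  \<comment> \<open>As \<open>e > 0\<close>, the equation determines \<open>w\<close> from
    \<open>u\<close>, so it suffices to count the values of \<open>u\<close>.\<close>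
  have inj: "inj_on fst Q"
    using pos by (auto simp: inj_on_def Q_def)
  have cong: "u mod e1 = u' mod e1" if "(u, w) \<in> Q" "(u', w') \<in> Q" for u w u' w'
  proof -
    have "int d * (2 * int u + int d) + int (d div b) = int e * (2 * int w + int e) + int (e div b)"
      "int d * (2 * int u' + int d) + int (d div b) = int e * (2 * int w' + int e) + int (e div b)"
      using that[unfolded Q_def mem_Collect_eq prod.case, THEN conjunct2, THEN conjunct2,
        THEN arg_cong[where f = int]]
      by (simp_all only: of_nat_add of_nat_mult of_nat_numeral)
    \<comment> \<open>Subtracting the two equations leaves only the terms that depend on the
      starting points. Dividing by \<open>g\<close> then makes the coefficients coprime.\<close>
    then have "int d * (int u - int u') = int e * (int w - int w')"
      by (simp add: algebra_simps)
    then have "int g * (int d1 * (int u - int u')) = int g * (int e1 * (int w - int w'))"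
      by (simp add: de mult.assoc)
    then have "int d1 * (int u - int u') = int e1 * (int w - int w')"
      using pos by simp
    then have "int e1 dvd int d1 * (int u - int u')"
      by simp
    then have "int e1 dvd int u - int u'"
      using de(3) by (simp add: coprime_dvd_mult_right_iff coprime_commute)
    then have "int u mod int e1 = int u' mod int e1"
      by (simp add: mod_eq_dvd_iff)
    then show ?thesis
      by (metis of_nat_mod of_nat_eq_iff)
  qed
  have "card Q = card (fst ` Q)"
    using inj by (simp add: card_image)
  also have "\<dots> \<le> 2 * M div e1 + 1"
  proof (rule card_congruent_subset_le[where a = 0])
    show "fst ` Q \<subseteq> {0..<0 + 2 * M}"
      by (auto simp: Q_def)
    show "x mod e1 = y mod e1" if "x \<in> fst ` Q" "y \<in> fst ` Q" for x y
      using that by (elim imageE) (metis cong prod.collapse)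
  qed (use pos in simp)
  \<comment> \<open>This uses \<open>M < e = g * e1\<close>. Adding 1 and using
    \<open>g >= 1\<close> produces the factor 3.\<close>
  also have "2 * M div e1 \<le> 2 * g"
  proof -
    have "2 * M \<le> (2 * g) * e1"
      using assms de by simp
    then show ?thesis
      using pos by (metis div_le_mono div_mult_self_is_m)
  qed
  finally have bound: "card Q \<le> 3 * g"
    using pos by simp
  \<comment> \<open>Modulo \<open>g\<close> both products vanish, so a solution forces
    \<open>d div b\<close> and \<open>e div b\<close> to be congruent.\<close>
  have "Q = {}" if "(d div b) mod g \<noteq> (e div b) mod g"
  proof (rule ccontr)
    assume "Q \<noteq> {}"
    then obtain u w where "d * (2 * u + d) + d div b = e * (2 * w + e) + e div b"
      unfolding Q_def by auto
    then have "(g * (d1 * (2 * u + d)) + d div b) mod g = (g * (e1 * (2 * w + e)) + e div b) mod g"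
      using de by (metis mult.assoc)
    with that show False
      by simp
  qed
  with bound show ?thesis
    unfolding g_def by auto
qed

section \<open>Counting multiples in intervals and in blocks of length \<open>b\<close>\<close>

lemma card_multiples_block_le:
  fixes a b g :: nat
  assumes "g > 0"
  shows "real (card {e \<in> {a..<a + b}. g dvd e}) \<le> real b / real g + 1"
proof -
  have "card {e \<in> {a..<a + b}. g dvd e} \<le> b div g + 1"
    by (rule card_congruent_subset_le) (use assms in auto)
  then have "real (card {e \<in> {a..<a + b}. g dvd e}) \<le> real (b div g) + 1"
    by linarith
  also have "real (b div g) \<le> real b / real g"
    by (rule of_nat_div_le_of_nat)
  finally show ?thesis
    by simp
qed

text \<open>The interval count \<open>M div g + 1\<close> has its additive 1 absorbed: if
  \<open>g \<le> M\<close> then \<open>M / g\<close> is at least 1, and otherwise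
  \<open>M div g = 0\<close> while \<open>2 * M / g\<close> is at least 1.\<close>

lemma card_multiples_dyadic_le:
  fixes M g :: nat
  assumes "g > 0" "g \<le> 2 * M"
  shows "real (card {d \<in> {M<..2 * M}. g dvd d}) \<le> 2 * real M / real g"
proof -
  have "card {d \<in> {M<..2 * M}. g dvd d} \<le> M div g + 1"
    by (rule card_congruent_subset_le[where a = "Suc M"]) (use assms in auto)
  then have le: "real (card {d \<in> {M<..2 * M}. g dvd d}) \<le> real (M div g) + 1"
    by linarith
  show ?thesis
  proof (cases "g \<le> M")
    case True
    have "real (M div g) + 1 \<le> real M / real g + real M / real g"
      using True assms by (intro add_mono of_nat_div_le_of_nat) simp
    with le show ?thesis
      by simp
  next
    case False
    have "1 \<le> real (2 * M) / real g"
      using assms by (subst le_divide_eq_1_pos) (simp_all only: of_nat_le_iff of_nat_0_less_iff)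
    moreover have "M div g = 0"
      using False by simp
    ultimately show ?thesis
      using le by simp
  qed
qed

text \<open>Leaving out \<open>d\<close> is what removes the additive 1: another multiple of
  \<open>g\<close> in the block of \<open>d\<close> is at distance at least \<open>g\<close> from
  \<open>d\<close>, so either there is none or \<open>g \<le> b\<close>.\<close>

lemma card_same_block_le:
  fixes b d g :: nat
  assumes "b > 0" "g > 0" "g dvd d"
  shows "real (card {e. e \<noteq> d \<and> g dvd e \<and> e div b = d div b}) \<le> 2 * real b / real g"
proof (cases "{e. e \<noteq> d \<and> g dvd e \<and> e div b = d div b} = {}")
  case True
  then show ?thesis
    by (metis card.empty divide_nonneg_nonneg mult_nonneg_nonneg of_nat_0 of_nat_0_le_iff
        zero_le_numeral)
next
  case False
  have block: "e \<in> {d div b * b..<d div b * b + b}" if "e div b = d div b" for e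
    using assms(1) that by (metis atLeastLessThan_iff dividend_less_div_times div_times_less_eq_dividend add.commute)
  obtain e where e: "e \<noteq> d" "g dvd e" "e div b = d div b"
    using False by blast
  have "int e \<noteq> int d" "int g dvd int e - int d"
    using e assms by auto
  then have "int g \<le> \<bar>int e - int d\<bar>"
    by (intro zdvd_imp_le) auto
  then have "g \<le> b"
    using block[OF e(3)] block[OF refl] unfolding atLeastLessThan_iff by linarith
  have "{e. e \<noteq> d \<and> g dvd e \<and> e div b = d div b}
      \<subseteq> {e \<in> {d div b * b..<d div b * b + b}. g dvd e}"
    using block by blast
  then have "card {e. e \<noteq> d \<and> g dvd e \<and> e div b = d div b}
      \<le> card {e \<in> {d div b * b..<d div b * b + b}. g dvd e}"
    by (intro card_mono) auto
  then have "real (card {e. e \<noteq> d \<and> g dvd e \<and> e div b = d div b}) \<le> real b / real g + 1"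
    using card_multiples_block_le[OF assms(2), of "d div b * b" b] by linarith
  also have "1 \<le> real b / real g"
    using \<open>g \<le> b\<close> assms by simp
  finally show ?thesis
    by simp
qed

text \<open>As for multiples in one block, a second member of the residue class forces
  \<open>g \<le> K\<close>, so no additive error survives.\<close>

lemma card_congruent_others_le:
  fixes K k\<^sub>0 g :: nat
  assumes "g > 0" "k\<^sub>0 \<le> K"
  shows "real (card {k. k \<le> K \<and> k \<noteq> k\<^sub>0 \<and> k mod g = k\<^sub>0 mod g}) \<le> 2 * real K / real g"
proof (cases "{k. k \<le> K \<and> k \<noteq> k\<^sub>0 \<and> k mod g = k\<^sub>0 mod g} = {}")
  case True
  show ?thesis
    unfolding True by simp
next
  case False
  let ?A = "{k. k \<le> K \<and> k \<noteq> k\<^sub>0 \<and> k mod g = k\<^sub>0 mod g}"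
  obtain k where k: "k \<le> K" "k \<noteq> k\<^sub>0" "k mod g = k\<^sub>0 mod g"
    using False by blast
  have "int k mod int g = int k\<^sub>0 mod int g"
    using k by (simp flip: of_nat_mod)
  then have "int g dvd int k - int k\<^sub>0"
    by (simp add: mod_eq_dvd_iff)
  then have "int g \<le> \<bar>int k - int k\<^sub>0\<bar>"
    using k by (intro zdvd_imp_le) auto
  then have "g \<le> K"
    using k assms by auto
  \<comment> \<open>Counting with \<open>k\<^sub>0\<close> put back in makes the additive 1 of the
    general bound cancel exactly.\<close>
  have "card (insert k\<^sub>0 ?A) \<le> (K + 1) div g + 1"
    by (rule card_congruent_subset_le[where a = 0]) (use assms in auto)
  then have "card ?A \<le> (K + 1) div g"
    by (subst (asm) card_insert_disjoint) auto
  then have "real (card ?A) \<le> real ((K + 1) div g)"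
    by simp
  also have "\<dots> \<le> real (K + 1) / real g"
    by (rule of_nat_div_le_of_nat)
  also have "\<dots> \<le> 2 * real K / real g"
    using \<open>g \<le> K\<close> assms by (intro divide_right_mono) auto
  finally show ?thesis .
qed

text \<open>Sort by the block index \<open>e div b\<close>: the first factor bounds the number of
  admissible indices, the second the multiples of \<open>g\<close> within one block.\<close>

lemma card_congruent_blocks_le:
  fixes N b d g :: nat
  assumes "b > 0" "g > 0" "d \<le> N"
  shows "real (card {e. e \<le> N \<and> g dvd e \<and> e div b \<noteq> d div b \<and> (e div b) mod g = (d div b) mod g})
    \<le> (2 * real (N div b) / real g) * (real b / real g + 1)"
    (is "real (card ?T) \<le> _")
proof -
  define B where "B = {k. k \<le> N div b \<and> k \<noteq> d div b \<and> k mod g = (d div b) mod g}"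
  have fin: "finite B"
    unfolding B_def by simp
  have block: "e \<in> {e div b * b..<e div b * b + b}" for e
    using assms(1) by (metis atLeastLessThan_iff dividend_less_div_times div_times_less_eq_dividend add.commute)
  have "?T \<subseteq> (\<Union>k\<in>B. {e \<in> {k * b..<k * b + b}. g dvd e})"
  proof
    fix e assume "e \<in> ?T"
    then have "e div b \<in> B" "e \<in> {e \<in> {e div b * b..<e div b * b + b}. g dvd e}"
      using block[of e] by (auto simp: B_def div_le_mono)
    then show "e \<in> (\<Union>k\<in>B. {e \<in> {k * b..<k * b + b}. g dvd e})"
      by blast
  qed
  then have "card ?T \<le> card (\<Union>k\<in>B. {e \<in> {k * b..<k * b + b}. g dvd e})"
    using fin by (intro card_mono) auto
  also have "\<dots> \<le> (\<Sum>k\<in>B. card {e \<in> {k * b..<k * b + b}. g dvd e})"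
    using fin by (rule card_UN_le)
  finally have "real (card ?T) \<le> (\<Sum>k\<in>B. real (card {e \<in> {k * b..<k * b + b}. g dvd e}))"
    by (simp flip: of_nat_sum)
  also have "\<dots> \<le> (\<Sum>k\<in>B. real b / real g + 1)"
    using assms by (intro sum_mono card_multiples_block_le) auto
  also have "\<dots> = real (card B) * (real b / real g + 1)"
    by simp
  also have "\<dots> \<le> (2 * real (N div b) / real g) * (real b / real g + 1)"
    unfolding B_def using assms
    by (intro mult_right_mono card_congruent_others_le) (auto simp: div_le_mono)
  finally show ?thesis .
qed

section \<open>The gcd sum over compatible pairs of lengths\<close>

text \<open>The diagonal gives at most \<open>M\<close> terms of size at most \<open>2 * M\<close>.
  Off the diagonal, the gcd is overcounted by the sum of all compatible common divisors
  \<open>g\<close>. For each \<open>g\<close> there are at most \<open>2 * M / g\<close> choices of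
  \<open>d\<close>, whose denominator cancels the weight \<open>g\<close>; the partners
  \<open>e\<close> are counted separately in the block of \<open>d\<close> and in other
  blocks.\<close>

lemma sum_compatible_gcd_le:
  fixes M b :: nat
  assumes "b > 0"
  defines "D \<equiv> {M<..2 * M}"
  shows "(\<Sum>d\<in>D. \<Sum>e\<in>D. if (d div b) mod gcd d e = (e div b) mod gcd d e then real (gcd d e) else 0)
    \<le> 2 * (real M)\<^sup>2 + (\<Sum>g=1..2 * M. 2 * real M *
        (2 * real b / real g + (2 * real (2 * M div b) / real g) * (real b / real g + 1)))"
    (is "(\<Sum>d\<in>D. \<Sum>e\<in>D. ?w d e) \<le> _ + (\<Sum>g=1..2 * M. 2 * real M * ?B g)")
proof -
  define T where "T g d = {e \<in> D. e \<noteq> d \<and> g dvd e \<and> (d div b) mod g = (e div b) mod g}" for g d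
  have finD: "finite D" and cardD: "card D = M"
    unfolding D_def by auto
  have finT: "finite (T g d)" for g d
    unfolding T_def using finD by simp
  have B_nonneg: "?B g \<ge> 0" for g
    by simp
  have cardT: "real (card (T g d)) \<le> ?B g" if "g > 0" "g dvd d" "d \<in> D" for g d
  proof -
    let ?T1 = "{e. e \<noteq> d \<and> g dvd e \<and> e div b = d div b}"
    let ?T2 = "{e. e \<le> 2 * M \<and> g dvd e \<and> e div b \<noteq> d div b \<and> (e div b) mod g = (d div b) mod g}"
    have "T g d \<subseteq> ?T1 \<union> ?T2"
      unfolding T_def D_def by auto
    moreover have fin1: "finite ?T1"
    proof (rule finite_subset)
      show "?T1 \<subseteq> {..<d div b * b + b}"
        using assms(1) by (auto simp: add.commute) (metis dividend_less_div_times)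
    qed simp
    ultimately have "card (T g d) \<le> card (?T1 \<union> ?T2)"
      by (intro card_mono) auto
    also have "\<dots> \<le> card ?T1 + card ?T2"
      by (rule card_Un_le)
    finally have "real (card (T g d)) \<le> real (card ?T1) + real (card ?T2)"
      by linarith
    also have "\<dots> \<le> ?B g"
      using assms that
      by (intro add_mono card_same_block_le card_congruent_blocks_le) (auto simp: D_def)
    finally show ?thesis .
  qed
  have inner: "(\<Sum>e\<in>D. ?w d e) \<le> 2 * real M + (\<Sum>g=1..2 * M. if g dvd d then real g * ?B g else 0)"
    if "d \<in> D" for d
  proof -
    \<comment> \<open>The single summand at \<open>g = gcd d e\<close> already equals the weight,
      and the others are nonnegative.\<close>
    have "?w d e \<le> (\<Sum>g=1..2 * M. if g dvd d \<and> e \<in> T g d then real g else 0)"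
      if "e \<in> D - {d}" for e
    proof (cases "(d div b) mod gcd d e = (e div b) mod gcd d e")
      case True
      have pos: "d > 0" "d \<le> 2 * M"
        using \<open>d \<in> D\<close> unfolding D_def by auto
      then have "gcd d e \<le> 2 * M"
        using gcd_le1_nat[of d e] by linarith
      then have mem: "gcd d e \<in> {1..2 * M}"
        using pos by (simp add: Suc_le_eq)
      have "gcd d e dvd d \<and> e \<in> T (gcd d e) d"
        using that True unfolding T_def by auto
      then have "?w d e = (if gcd d e dvd d \<and> e \<in> T (gcd d e) d then real (gcd d e) else 0)"
        using True by simp
      also have "\<dots> \<le> (\<Sum>g=1..2 * M. if g dvd d \<and> e \<in> T g d then real g else 0)"
        using mem by (intro member_le_sum[where f = "\<lambda>g. if g dvd d \<and> e \<in> T g d then real g else 0"]) auto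
      finally show ?thesis .
    next
      case False
      then show ?thesis
        by (auto intro!: sum_nonneg)
    qed
    then have "(\<Sum>e\<in>D - {d}. ?w d e)
        \<le> (\<Sum>e\<in>D - {d}. \<Sum>g=1..2 * M. if g dvd d \<and> e \<in> T g d then real g else 0)"
      by (rule sum_mono)
    also have "\<dots> = (\<Sum>g=1..2 * M. \<Sum>e\<in>D - {d}. if g dvd d \<and> e \<in> T g d then real g else 0)"
      by (rule sum.swap)
    also have "\<dots> \<le> (\<Sum>g=1..2 * M. if g dvd d then real g * ?B g else 0)"
    proof (rule sum_mono)
      fix g assume g: "g \<in> {1..2 * M}"
      show "(\<Sum>e\<in>D - {d}. if g dvd d \<and> e \<in> T g d then real g else 0)
          \<le> (if g dvd d then real g * ?B g else 0)"
      proof (cases "g dvd d")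
        case True
        have "(\<Sum>e\<in>D - {d}. if g dvd d \<and> e \<in> T g d then real g else 0)
            = (\<Sum>e\<in>(D - {d}) \<inter> T g d. real g)"
          using True finD by (subst sum.inter_restrict) auto
        also have "(D - {d}) \<inter> T g d = T g d"
          unfolding T_def by auto
        also have "(\<Sum>e\<in>T g d. real g) = real g * real (card (T g d))"
          by simp
        also have "\<dots> \<le> real g * ?B g"
          using cardT[of g d] True g that by (intro mult_left_mono) auto
        finally show ?thesis
          using True by simp
      qed simp
    qed
    finally have "(\<Sum>e\<in>D - {d}. ?w d e) \<le> (\<Sum>g=1..2 * M. if g dvd d then real g * ?B g else 0)" .
    moreover have "?w d d \<le> 2 * real M"
      using that unfolding D_def by simp
    moreover have "(\<Sum>e\<in>D. ?w d e) = ?w d d + (\<Sum>e\<in>D - {d}. ?w d e)"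
      using finD that by (rule sum.remove)
    ultimately show ?thesis
      by linarith
  qed
  have "(\<Sum>d\<in>D. \<Sum>e\<in>D. ?w d e)
      \<le> (\<Sum>d\<in>D. 2 * real M + (\<Sum>g=1..2 * M. if g dvd d then real g * ?B g else 0))"
    using inner by (rule sum_mono)
  also have "\<dots> = 2 * (real M)\<^sup>2 + (\<Sum>d\<in>D. \<Sum>g=1..2 * M. if g dvd d then real g * ?B g else 0)"
    by (simp add: sum.distrib cardD power2_eq_square)
  also have "(\<Sum>d\<in>D. \<Sum>g=1..2 * M. if g dvd d then real g * ?B g else 0)
      = (\<Sum>g=1..2 * M. \<Sum>d\<in>D. if g dvd d then real g * ?B g else 0)"
    by (rule sum.swap)
  also have "\<dots> \<le> (\<Sum>g=1..2 * M. 2 * real M * ?B g)"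
  proof (rule sum_mono)
    fix g assume g: "g \<in> {1..2 * M}"
    have "(\<Sum>d\<in>D. if g dvd d then real g * ?B g else 0) = (\<Sum>d\<in>{d \<in> D. g dvd d}. real g * ?B g)"
      using finD by (simp only: sum.inter_filter)
    also have "\<dots> = real (card {d \<in> D. g dvd d}) * (real g * ?B g)"
      by simp
    also have "\<dots> \<le> (2 * real M / real g) * (real g * ?B g)"
      unfolding D_def using g
      by (intro mult_right_mono card_multiples_dyadic_le mult_nonneg_nonneg B_nonneg) auto
    also have "\<dots> = 2 * real M * ?B g"
      using g by simp
    finally show "(\<Sum>d\<in>D. if g dvd d then real g * ?B g else 0) \<le> 2 * real M * ?B g" .
  qed
  finally show ?thesis
    by simp
qed

text \<open>With \<open>H\<close> and \<open>Z\<close> as below and \<open>K = 2 * M div b\<close>,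
  the sum over \<open>g\<close> equals \<open>4 * M * (b * H + K * b * Z + K * H)\<close>. The upper
  bound on \<open>b\<close> controls \<open>b * H\<close> by \<open>14 * M\<close>, the lower bound
  controls \<open>K * H\<close> by \<open>4 * M\<close>, and \<open>K * b * Z\<close> is at most
  \<open>4 * M\<close> in any case. The constant is \<open>90 = 2 + 4 * 22\<close>.\<close>

lemma sum_compatible_gcd_le_square:
  fixes n b :: nat
  assumes "n \<ge> 4" "b > 0" "ln (real n) \<le> real b" "real b * (ln (real n))\<^sup>2 \<le> real n"
  defines "M \<equiv> n div 4"
  shows "(\<Sum>d\<in>{M<..2 * M}. \<Sum>e\<in>{M<..2 * M}.
      if (d div b) mod gcd d e = (e div b) mod gcd d e then real (gcd d e) else 0) \<le> 90 * (real M)\<^sup>2"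
proof -
  define K where "K = 2 * M div b"
  define H where "H = (\<Sum>g=1..2 * M. 1 / real g)"
  define Z where "Z = (\<Sum>g=1..2 * M. 1 / (real g)\<^sup>2)"
  have "M > 0" and "2 * M \<le> n" and "n \<le> 7 * M"
    using assms(1) unfolding M_def by presburger+
  then have M: "real M > 0" "real n \<le> 7 * real M" "real (2 * M) \<le> real n"
    by linarith+
  \<comment> \<open>From \<open>ln n >= 1\<close> follow both \<open>1 + ln n \<le> 2 * ln n\<close>
    and \<open>ln n \<le> (ln n)^2\<close>.\<close>
  have "exp 1 \<le> real n"
    using exp_le assms(1) by linarith
  then have L1: "ln (real n) \<ge> 1"
    using assms(1) by (simp add: ln_ge_iff)
  have "H \<le> 1 + ln (real (2 * M))"
    unfolding H_def using \<open>M > 0\<close> by (intro sum_inverse_le_ln) simp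
  also have "ln (real (2 * M)) \<le> ln (real n)"
    using M by (intro ln_mono) auto
  finally have HL: "H \<le> 2 * ln (real n)"
    using L1 by simp
  have "real (K * b) \<le> real (2 * M)"
    unfolding K_def by (subst of_nat_le_iff) (rule div_times_less_eq_dividend)
  then have Kb: "real K * real b \<le> 2 * real M"
    by simp
  have "real b * H \<le> real b * (2 * ln (real n))"
    using HL by (intro mult_left_mono) auto
  also have "\<dots> \<le> 2 * (real b * (ln (real n))\<^sup>2)"
    using L1 by (simp add: power2_eq_square mult_left_mono)
  finally have bH: "real b * H \<le> 14 * real M"
    using assms(4) M by linarith
  have "real K * H \<le> real K * (2 * real b)"
    using HL assms(3) by (intro mult_left_mono) auto
  then have KH: "real K * H \<le> 4 * real M"
    using Kb by simp
  have "(real K * real b) * Z \<le> (2 * real M) * 2"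
    by (rule mult_mono[OF Kb]) (auto simp: Z_def sum_inverse_squares_le simp del: One_nat_def intro: sum_nonneg)
  with bH KH have "real b * H + real K * real b * Z + real K * H \<le> 22 * real M"
    by linarith
  then have "4 * real M * (real b * H + real K * real b * Z + real K * H) \<le> 4 * real M * (22 * real M)"
    using M by (intro mult_left_mono) auto
  moreover have "(\<Sum>g=1..2 * M. 2 * real M *
        (2 * real b / real g + (2 * real K / real g) * (real b / real g + 1)))
      = 4 * real M * (real b * H + real K * real b * Z + real K * H)"
    unfolding H_def Z_def sum_distrib_left sum.distrib[symmetric]
    by (intro sum.cong) (auto simp: field_simps power2_eq_square)
  ultimately show ?thesis
    using sum_compatible_gcd_le[OF assms(2), of M] unfolding K_def
    by (simp add: power2_eq_square)
qed

section \<open>The lower bound for the number of consecutive sums\<close>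

lemma finite_consecutive_sums: "finite (consecutive_sums k a)"
proof (rule finite_subset)
  show "consecutive_sums k a \<subseteq> (\<lambda>(u, v). \<Sum>i=u..v. a i) ` ({..k} \<times> {..k})"
    unfolding consecutive_sums_def by auto
qed simp

lemma card_consecutive_sums_ge:
  fixes n b :: nat
  assumes "n \<ge> 4" "b > 0" "ln (real n) \<le> real b" "real b * (ln (real n))\<^sup>2 \<le> real n"
  shows "real (card (consecutive_sums n (perturbed_odd_seq b))) \<ge> (real n)\<^sup>2 / 13230"
proof -
  define M where "M = n div 4"
  define D where "D = {M<..2 * M}"
  define F where "F = (\<lambda>(d, u). int (d * (2 * u + d) + (u + d) div b) - int (u div b))"
  define P where "P k = {(d, u) \<in> D \<times> {..<2 * M}. (u + d) div b = u div b + d div b + k}" for k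
  define Q where "Q d e = {(u, w). u < 2 * M \<and> w < 2 * M \<and>
    d * (2 * u + d) + d div b = e * (2 * w + e) + e div b}" for d e
  have "M > 0" and "4 * M \<le> n" and "n \<le> 7 * M"
    using assms(1) unfolding M_def by presburger+
  have finP: "finite (P k)" for k
    unfolding P_def D_def by (rule finite_subset[of _ "{M<..2 * M} \<times> {..<2 * M}"]) auto
  have finQ: "finite (Q d e)" for d e
    unfolding Q_def by (rule finite_subset[of _ "{..<2 * M} \<times> {..<2 * M}"]) auto

  \<comment> \<open>The carry of \<open>u + d\<close> at \<open>b\<close> is \<open>0\<close> or \<open>1\<close>; once it is fixed, it cancels in every collision.\<close>
  have "D \<times> {..<2 * M} \<subseteq> P 0 \<union> P 1"
  proof
    fix x assume x: "x \<in> D \<times> {..<2 * M}"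
    obtain d u where du: "x = (d, u)"
      by (cases x)
    have "(u mod b + d mod b) div b < 2"
      using assms(2) by (intro less_mult_imp_div_less) (simp add: add_strict_mono mult_2)
    then have "(u mod b + d mod b) div b = 0 \<or> (u mod b + d mod b) div b = 1"
      by linarith
    then show "x \<in> P 0 \<union> P 1"
      using x unfolding du P_def by (auto simp: div_add1_eq[of u d b])
  qed
  then have "card (D \<times> {..<2 * M}) \<le> card (P 0) + card (P 1)"
    using finP card_Un_le[of "P 0" "P 1"] card_mono[of "P 0 \<union> P 1" "D \<times> {..<2 * M}"] by simp
  then have "2 * (M * M) \<le> card (P 0) + card (P 1)"
    by (simp add: card_cartesian_product D_def)
  \<comment> \<open>One of the two carry classes contains at least half of the
    \<open>2 * M^2\<close> pairs.\<close>
  then obtain k where "M * M \<le> card (P k)"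
    by (metis add_mono_thms_linordered_field(5) mult_2 not_le)
  then have cardP: "(real M)\<^sup>2 \<le> real (card (P k))"
    unfolding power2_eq_square by (metis of_nat_le_iff of_nat_mult)

  have "F ` P k \<subseteq> consecutive_sums n (perturbed_odd_seq b)"
  proof
    fix t assume "t \<in> F ` P k"
    then obtain d u where du: "d \<in> D" "u < 2 * M" "t = F (d, u)"
      unfolding P_def by auto
    then have "t = (\<Sum>i=u+1..u+d. perturbed_odd_seq b i)"
      using sum_perturbed_odd_seq[OF assms(2), of u d] unfolding F_def by simp
    moreover have "1 \<le> u + 1" "u + 1 \<le> u + d" "u + d \<le> n"
      using du \<open>4 * M \<le> n\<close> unfolding D_def by auto
    ultimately show "t \<in> consecutive_sums n (perturbed_odd_seq b)"
      unfolding consecutive_sums_def by blast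
  qed
  then have image: "card (F ` P k) \<le> card (consecutive_sums n (perturbed_odd_seq b))"
    by (intro card_mono finite_consecutive_sums)

  let ?C = "{(x, y) \<in> P k \<times> P k. F x = F y}"
  let ?rearrange = "\<lambda>((d::nat, u::nat), (e::nat, w::nat)). ((d, e), (u, w))"
  \<comment> \<open>Grouping collisions by their two lengths \<open>(d, e)\<close> reduces the count
    to the sets \<open>Q d e\<close> of starting points.\<close>
  have "card ?C \<le> card (SIGMA p:D \<times> D. Q (fst p) (snd p))"
  proof (rule card_inj_on_le)
    show "inj_on ?rearrange ?C"
      by (auto simp: inj_on_def)
    show "?rearrange ` ?C \<subseteq> (SIGMA p:D \<times> D. Q (fst p) (snd p))"
    proof
      fix z assume "z \<in> ?rearrange ` ?C"
      then obtain d u e w where z: "z = ((d, e), (u, w))" "(d, u) \<in> P k" "(e, w) \<in> P k" "F (d, u) = F (e, w)"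
        by auto
      have "(u + d) div b = u div b + d div b + k" "(w + e) div b = w div b + e div b + k"
        using z unfolding P_def by auto
      then have "int (d * (2 * u + d) + d div b) = int (e * (2 * w + e) + e div b)"
        using z(4) unfolding F_def prod.case by linarith
      then have "(u, w) \<in> Q d e"
        using z(2,3) unfolding Q_def P_def of_nat_eq_iff by simp
      then show "z \<in> (SIGMA p:D \<times> D. Q (fst p) (snd p))"
        using z unfolding P_def by auto
    qed
    show "finite (SIGMA p:D \<times> D. Q (fst p) (snd p))"
      using finQ unfolding D_def by (intro finite_SigmaI) auto
  qed
  also have "\<dots> = (\<Sum>p\<in>D \<times> D. card (Q (fst p) (snd p)))"
    using finQ unfolding D_def by (intro card_SigmaI) auto
  also have "\<dots> = (\<Sum>d\<in>D. \<Sum>e\<in>D. card (Q d e))"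
    by (simp add: sum.cartesian_product case_prod_unfold)
  finally have "real (card ?C) \<le> (\<Sum>d\<in>D. \<Sum>e\<in>D. real (card (Q d e)))"
    by (simp flip: of_nat_sum)
  also have "\<dots> \<le> (\<Sum>d\<in>D. \<Sum>e\<in>D.
      3 * (if (d div b) mod gcd d e = (e div b) mod gcd d e then real (gcd d e) else 0))"
  proof (intro sum_mono)
    fix d e assume "d \<in> D" "e \<in> D"
    then have "card (Q d e) \<le> (if (d div b) mod gcd d e = (e div b) mod gcd d e then 3 * gcd d e else 0)"
      unfolding D_def Q_def by (intro card_collisions_fixed_lengths) auto
    then show "real (card (Q d e))
        \<le> 3 * (if (d div b) mod gcd d e = (e div b) mod gcd d e then real (gcd d e) else 0)"
      by (simp split: if_splits)
  qed
  also have "\<dots> = 3 * (\<Sum>d\<in>D. \<Sum>e\<in>D.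
      if (d div b) mod gcd d e = (e div b) mod gcd d e then real (gcd d e) else 0)"
    by (simp only: sum_distrib_left)
  also have "\<dots> \<le> 3 * (90 * (real M)\<^sup>2)"
    using sum_compatible_gcd_le_square[OF assms] unfolding D_def M_def by simp
  finally have energy: "real (card ?C) \<le> 270 * (real M)\<^sup>2"
    by simp

  \<comment> \<open>At least \<open>M^2\<close> pairs with at most \<open>270 * M^2\<close>
    collisions must take at least \<open>M^2 / 270\<close> values.\<close>
  have "(real M)\<^sup>2 * (real M)\<^sup>2 \<le> (real (card (P k)))\<^sup>2"
    using cardP unfolding power2_eq_square[of "real (card (P k))"] by (intro mult_mono) auto
  also have "\<dots> \<le> real (card (F ` P k)) * real (card ?C)"
    using finP by (rule card_squared_le_card_image_times_collisions)
  also have "\<dots> \<le> real (card (consecutive_sums n (perturbed_odd_seq b))) * (270 * (real M)\<^sup>2)"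
    using image energy by (intro mult_mono) auto
  finally have "(real M)\<^sup>2 * (real M)\<^sup>2
      \<le> (270 * real (card (consecutive_sums n (perturbed_odd_seq b)))) * (real M)\<^sup>2"
    by (simp add: mult_ac)
  then have "(real M)\<^sup>2 \<le> 270 * real (card (consecutive_sums n (perturbed_odd_seq b)))"
    by (rule mult_right_le_imp_le) (use \<open>M > 0\<close> in simp)
  \<comment> \<open>The final constant is \<open>13230 = 270 * 7^2\<close>.\<close>
  moreover have "(real n)\<^sup>2 \<le> (7 * real M)\<^sup>2"
    using \<open>n \<le> 7 * M\<close> by (intro power_mono) linarith+
  ultimately show ?thesis
    by (simp add: power_mult_distrib)
qed

theorem theorem1p3:
  "\<exists>c\<^sub>3::real. c\<^sub>3 > 0 \<and>
    (\<forall>n b :: nat. n > 0 \<longrightarrow> b > 0 \<longrightarrow>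
      ln (real n) \<le> real b \<longrightarrow> real b * (ln (real n))\<^sup>2 \<le> real n \<longrightarrow>
      real (card (consecutive_sums n (perturbed_odd_seq b))) \<ge> c\<^sub>3 * (real n)\<^sup>2)"
proof (intro exI[of _ "1 / 13230"] conjI allI impI)
  fix n b :: nat
  assume asm: "n > 0" "b > 0" "ln (real n) \<le> real b" "real b * (ln (real n))\<^sup>2 \<le> real n"
  show "real (card (consecutive_sums n (perturbed_odd_seq b))) \<ge> 1 / 13230 * (real n)\<^sup>2"
  proof (cases "n \<ge> 4")
    case True
    then show ?thesis
      using card_consecutive_sums_ge[OF True asm(2-4)] by simp
  next
    case False
    \<comment> \<open>For \<open>n < 4\<close> one sum is enough, since \<open>n^2\<close> is at
      most 16, well below 13230.\<close>
    have "(\<Sum>i=1..1. perturbed_odd_seq b i) \<in> consecutive_sums n (perturbed_odd_seq b)"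
      unfolding consecutive_sums_def using asm(1)
      by (intro CollectI exI[of _ "1::nat"] conjI) auto
    then have "card (consecutive_sums n (perturbed_odd_seq b)) > 0"
      using finite_consecutive_sums card_gt_0_iff by blast
    moreover have "(real n)\<^sup>2 \<le> 4\<^sup>2"
      using False by (intro power_mono) auto
    ultimately show ?thesis
      by simp
  qed
qed simp

end
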